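(* For any $p\in[-1,1]$, $p\neq 0$, the operator $W$ has a unique fixed point in $S^4$, namely $P=(1/5,1/5,1/5,1/5,1/5)$. For $p=0$ likewise, $P$ is the unique fixed point of $W$. That is, for any $p\in[-1,1]$ the operator $W$ has the unique fixed point $P$.
   Context: $S^4=\{x=(x_1,\dots,x_5)\in\mathbb{R}^5: x_i\ge 0,\ \sum_{i=1}^5 x_i=1\}$. For $p\in[-1,1]$, the operator $W:S^4\to S^4$, $W(x)=x'$, is defined by $$\begin{aligned} x'_1&=x_5[1+p(x_1-x_2+x_3-x_4)],\\ x'_2&=x_1[1+p(x_2-x_3+x_4-x_5)],\\ x'_3&=x_2[1-p(x_1-x_3+x_4-x_5)],\\ x'_4&=x_3[1+p(x_1-x_2+x_4-x_5)],\\ x'_5&=x_4[1-p(x_1-x_2+x_3-x_5)]. \end{aligned}$$ A fixed point of $W$ is a point $x\in S^4$ with $W(x)=x$. *)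

theory Defs
  imports "HOL-Analysis.Analysis"
begin

text \<open>The five coordinates are indexed by the numeral type \<^typ>\<open>5\<close>, whose elements are
  \<open>1, 2, 3, 4, 5\<close> (with \<open>5 = 0\<close>).\<close>

definition S4 :: "(real ^ 5) set" where
  "S4 = {x. (\<forall>i. x $ i \<ge> 0) \<and> (\<Sum>i\<in>UNIV. x $ i) = 1}"

definition W :: "real \<Rightarrow> real ^ 5 \<Rightarrow> real ^ 5" where
  "W p x = vector
    [x$5 * (1 + p * (x$1 - x$2 + x$3 - x$4)),
     x$1 * (1 + p * (x$2 - x$3 + x$4 - x$5)),
     x$2 * (1 - p * (x$1 - x$3 + x$4 - x$5)),
     x$3 * (1 + p * (x$1 - x$2 + x$4 - x$5)),
     x$4 * (1 - p * (x$1 - x$2 + x$3 - x$5))]"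

definition P :: "real ^ 5" where
  "P = (\<chi> i. 1 / 5)"

lemma UNIV_5: "(UNIV :: 5 set) = {1, 2, 3, 4, 5}"
proof -
  have "i \<in> {1, 2, 3, 4, 5}" for i :: 5
  proof (induct i)
    case (of_int z)
    then have "0 \<le> z" "z < 5" by simp_all
    then have "z = 0 \<or> z = 1 \<or> z = 2 \<or> z = 3 \<or> z = 4" by arith
    then show ?case by auto
  qed
  then show ?thesis by auto
qed

lemma W_nth:
  "W p x $ 1 = x$5 * (1 + p * (x$1 - x$2 + x$3 - x$4))"
  "W p x $ 2 = x$1 * (1 + p * (x$2 - x$3 + x$4 - x$5))"
  "W p x $ 3 = x$2 * (1 - p * (x$1 - x$3 + x$4 - x$5))"
  "W p x $ 4 = x$3 * (1 + p * (x$1 - x$2 + x$4 - x$5))"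
  "W p x $ 5 = x$4 * (1 - p * (x$1 - x$2 + x$3 - x$5))"
  by (simp_all add: W_def vector_def)

lemma sum_UNIV_5: "(\<Sum>i\<in>UNIV. f i) = f 1 + f 2 + f 3 + f 4 + f (5::5)"
  for f :: "5 \<Rightarrow> real"
  unfolding UNIV_5 by simp

lemma W_maps_S4:
  assumes "p \<in> {-1..1}"
  shows "W p \<in> S4 \<rightarrow> S4"
proof
  fix x :: "real ^ 5"
  assume "x \<in> S4"
  then have nonneg: "x$1 \<ge> 0" "x$2 \<ge> 0" "x$3 \<ge> 0" "x$4 \<ge> 0" "x$5 \<ge> 0"
    and total: "x$1 + x$2 + x$3 + x$4 + x$5 = 1"
    by (simp_all add: S4_def sum_UNIV_5)
  have bound: "\<bar>p * t\<bar> \<le> 1" if "\<bar>t\<bar> \<le> 1" for t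
  proof -
    have "\<bar>p\<bar> \<le> 1" using assms by auto
    then show ?thesis
      using that mult_le_one[of "\<bar>p\<bar>" "\<bar>t\<bar>"] by (simp add: abs_mult)
  qed
  have pos: "1 + p * t \<ge> 0" "1 - p * t \<ge> 0" if "\<bar>t\<bar> \<le> 1" for t
    using bound[OF that] by linarith+
  have "W p x $ i \<ge> 0" for i
  proof -
    have "i \<in> {1, 2, 3, 4, 5}" using UNIV_I[of i] unfolding UNIV_5 .
    moreover have "W p x $ 1 \<ge> 0" "W p x $ 2 \<ge> 0" "W p x $ 3 \<ge> 0" "W p x $ 4 \<ge> 0" "W p x $ 5 \<ge> 0"
      unfolding W_nth using nonneg total
      by (intro mult_nonneg_nonneg pos; linarith)+
    ultimately show ?thesis by auto
  qed
  moreover have "(\<Sum>i\<in>UNIV. W p x $ i) = x$1 + x$2 + x$3 + x$4 + x$5"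
    by (simp only: sum_UNIV_5 W_nth) (simp add: algebra_simps)
  ultimately show "W p x \<in> S4"
    using total by (simp add: S4_def)
qed

end

theory Submission imports Defs begin

text \<open>
  Each coordinate of \<^term>\<open>W p x\<close> is the cyclically preceding coordinate of \<open>x\<close> multiplied by
  a growth factor \<open>1 + p * \<ell>(x)\<close> with \<open>\<ell>\<close> linear. At a fixed point a vanishing coordinate would
  force its successor, and hence all coordinates, to vanish; so a fixed point in the simplex has
  positive coordinates (\<open>fixed_point_positive\<close>), and the growth factors are the
  ratios of cyclically consecutive coordinates. Their product is therefore 1. On the other hand the five linear forms \<open>\<ell>\<close> add up
  to 0 identically, so the growth factors have arithmetic mean 1 as well. Equality in the
  inequality between the arithmetic and the geometric mean (\<open>all_one_if_prod_one_sum_card\<close>)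
  makes all factors equal to 1, that is, all coordinates are equal.
\<close>

text \<open>The equality case of the arithmetic-geometric mean inequality at mean 1. The logarithm lies
  below its tangent at 1 and meets it only there; the gaps between tangent and logarithm
  at the factors are nonnegative and sum to 0, so each of them is 0.\<close>

lemma all_one_if_prod_one_sum_card:
  fixes r :: "'a \<Rightarrow> real"
  assumes "finite A" and pos: "\<And>i. i \<in> A \<Longrightarrow> r i > 0"
    and prod: "(\<Prod>i\<in>A. r i) = 1" and sum: "(\<Sum>i\<in>A. r i) = card A"
    and "i \<in> A"
  shows "r i = 1"
proof -
  have gap: "r j - 1 - ln (r j) \<ge> 0" if "j \<in> A" for j
    using ln_le_minus_one[OF pos[OF that]] by simp
  have "(\<Sum>j\<in>A. ln (r j)) = 0"
    using ln_prod[OF \<open>finite A\<close>, of r] pos prod by force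
  then have "(\<Sum>j\<in>A. r j - 1 - ln (r j)) = 0"
    using sum by (simp add: sum_subtractf)
  then have "r i - 1 - ln (r i) = 0"
    using sum_nonneg_eq_0_iff[of A "\<lambda>j. r j - 1 - ln (r j)"] gap \<open>finite A\<close> \<open>i \<in> A\<close> by blast
  then show ?thesis
    using ln_eq_minus_one[OF pos[OF \<open>i \<in> A\<close>]] by simp
qed

lemma P_fixed_point: "P \<in> {x \<in> S4. W p x = x}"
proof -
  have "W p P $ i = P $ i" for i
  proof -
    have "i \<in> {1, 2, 3, 4, 5}" using UNIV_I[of i] unfolding UNIV_5 .
    moreover have "W p P $ 1 = P $ 1" "W p P $ 2 = P $ 2" "W p P $ 3 = P $ 3"
      "W p P $ 4 = P $ 4" "W p P $ 5 = P $ 5"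
      unfolding W_nth by (simp_all add: P_def)
    ultimately show ?thesis by auto
  qed
  moreover have "P \<in> S4"
    unfolding S4_def sum_UNIV_5 by (simp add: P_def)
  ultimately show ?thesis by (simp add: vec_eq_iff)
qed

lemma fixed_point_positive:
  assumes "x \<in> S4" and fixed: "W p x = x"
  shows "x $ i > 0"
proof -
  have cycle: "x$5 = 0 \<Longrightarrow> x$1 = 0" "x$1 = 0 \<Longrightarrow> x$2 = 0" "x$2 = 0 \<Longrightarrow> x$3 = 0"
    "x$3 = 0 \<Longrightarrow> x$4 = 0" "x$4 = 0 \<Longrightarrow> x$5 = 0"
    using W_nth[of p x] unfolding fixed by simp_all
  have "x$1 + x$2 + x$3 + x$4 + x$5 = 1"
    using assms(1) by (simp add: S4_def sum_UNIV_5)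
  then have "x$1 \<noteq> 0 \<and> x$2 \<noteq> 0 \<and> x$3 \<noteq> 0 \<and> x$4 \<noteq> 0 \<and> x$5 \<noteq> 0"
    using cycle by fastforce
  moreover have "i \<in> {1, 2, 3, 4, 5}" using UNIV_I[of i] unfolding UNIV_5 .
  ultimately have "x $ i \<noteq> 0" by auto
  moreover have "x $ i \<ge> 0" using assms(1) by (simp add: S4_def)
  ultimately show ?thesis by simp
qed

text \<open>The growth factors at a fixed point, taken as quotients of consecutive coordinates: this
  form makes their product telescope, while the fixed point equations evaluate their sum.\<close>

lemma fixed_point_unique:
  assumes "x \<in> S4" and fixed: "W p x = x"
  shows "x = P"
proof -
  note pos = fixed_point_positive[OF assms]
  have nz: "x $ i \<noteq> 0" for i using pos[of i] by simp
  define r where "r i = x $ i / x $ (i - 1)" for i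
  have wrap: "(0 :: 5) = 5" by simp
  have r: "r 1 = x$1 / x$5" "r 2 = x$2 / x$1" "r 3 = x$3 / x$2" "r 4 = x$4 / x$3" "r 5 = x$5 / x$4"
    by (simp_all add: r_def wrap)
  have "r 1 = 1 + p * (x$1 - x$2 + x$3 - x$4)" "r 2 = 1 + p * (x$2 - x$3 + x$4 - x$5)"
    "r 3 = 1 - p * (x$1 - x$3 + x$4 - x$5)" "r 4 = 1 + p * (x$1 - x$2 + x$4 - x$5)"
    "r 5 = 1 - p * (x$1 - x$2 + x$3 - x$5)"
    unfolding r using W_nth[of p x] nz unfolding fixed
    by (metis nonzero_mult_div_cancel_left)+
  then have "r 1 + r 2 + r 3 + r 4 + r 5 = 5"
    by (simp add: algebra_simps)
  then have sum: "(\<Sum>i\<in>UNIV. r i) = CARD(5)"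
    by (simp add: sum_UNIV_5)
  have "(\<Prod>i\<in>UNIV. r i) = r 1 * r 2 * r 3 * r 4 * r 5"
    unfolding UNIV_5 by simp
  also have "\<dots> = 1"
    unfolding r using nz by simp
  finally have prod: "(\<Prod>i\<in>UNIV. r i) = 1" .
  have "r i = 1" for i
    by (rule all_one_if_prod_one_sum_card[OF _ _ prod sum]) (simp_all add: r_def pos)
  then have eq: "x$1 = x$5" "x$2 = x$1" "x$3 = x$2" "x$4 = x$3"
    using r nz by (metis divide_eq_1_iff)+
  have "x$1 + x$2 + x$3 + x$4 + x$5 = 1"
    using assms(1) by (simp add: S4_def sum_UNIV_5)
  then have fifth: "x$1 = 1/5" "x$2 = 1/5" "x$3 = 1/5" "x$4 = 1/5" "x$5 = 1/5"
    using eq by linarith+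
  have "x $ i = 1/5" for i
  proof -
    have "i \<in> {1, 2, 3, 4, 5}" using UNIV_I[of i] unfolding UNIV_5 .
    then show ?thesis using fifth by auto
  qed
  then show ?thesis by (simp add: P_def vec_eq_iff)
qed

theorem proposition1:
  fixes p :: real
  assumes "p \<in> {-1..1}"
  shows "{x \<in> S4. W p x = x} = {P}"
  using P_fixed_point fixed_point_unique by blast

end
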